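(* Let $G$ be a graph on $n$ vertices of diameter at most $3$. Then $c(G)<n^{\frac{4}{7}+o(1)}$, where $o(1)$ denotes a quantity tending to $0$ as $n\to\infty$.
   Context: Cops and Robbers on a graph $G$: first each of $k$ cops chooses an initial vertex, then the robber chooses an initial vertex. Then the players alternate, starting with the cops: in a cops' turn every cop either stays at its vertex or moves to an adjacent vertex, and in the robber's turn the robber stays or moves to an adjacent vertex. Several cops may occupy the same vertex, and both players have full information. The cops win if, whatever the robber does, after some cops' move some cop occupies the robber's vertex. The cop number $c(G)$ is the least $k$ for which the cops win. *)

theory Defs
  imports Complex_Main "Graph_Theory.Graph_Theory"
begin

text \<open>The diameter is the largest distance between two vertices, where a distance is the
  infimum of the lengths of the walks (total cost when every arc costs 1);
  it is infinite for disconnected graphs.\<close>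

definition graph_diameter :: "'a pair_pre_digraph \<Rightarrow> ereal" where
  "graph_diameter G =
     (SUP u\<in>pverts G. SUP v\<in>pverts G. wf_digraph.\<mu> (with_proj G) (\<lambda>_. 1) u v)"

definition game_move :: "'a pair_pre_digraph \<Rightarrow> 'a \<Rightarrow> 'a \<Rightarrow> bool" where
  "game_move G u v \<longleftrightarrow> u = v \<or> (u, v) \<in> parcs G"

text \<open>The robber's behaviour in one play: \<open>r 0\<close> is the initial vertex, \<open>r t\<close> the vertex
  after \<open>t\<close> robber moves. As a winning cop strategy has to beat all of these sequences, it beats
  a robber who reacts to the cops.\<close>

definition robber_play :: "'a pair_pre_digraph \<Rightarrow> (nat \<Rightarrow> 'a) \<Rightarrow> bool" where
  "robber_play G r \<longleftrightarrow> r 0 \<in> pverts G \<and> (\<forall>t. game_move G (r t) (r (Suc t)))"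

text \<open>A strategy \<open>s\<close> for \<open>k\<close> cops maps the list of robber vertices seen so far to the position
  of each cop \<open>i < k\<close>: \<open>s []\<close> is the initial placement, chosen before the robber appears, and
  \<open>s [r 0, \<dots>, r t]\<close> is the placement after the cops' answer to \<open>r t\<close>. The cops' own earlier
  positions are determined by \<open>s\<close>, so this covers full information.\<close>

definition cop_strategy :: "'a pair_pre_digraph \<Rightarrow> nat \<Rightarrow> ('a list \<Rightarrow> nat \<Rightarrow> 'a) \<Rightarrow> bool" where
  "cop_strategy G k s \<longleftrightarrow>
     (\<forall>i<k. s [] i \<in> pverts G) \<and>
     (\<forall>r t. robber_play G r \<longrightarrow>
        (\<forall>i<k. game_move G (s (map r [0..<t]) i) (s (map r [0..<Suc t]) i)))"

definition cops_win :: "'a pair_pre_digraph \<Rightarrow> nat \<Rightarrow> bool" where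
  "cops_win G k \<longleftrightarrow>
     (\<exists>s. cop_strategy G k s \<and>
        (\<forall>r. robber_play G r \<longrightarrow> (\<exists>t. \<exists>i<k. s (map r [0..<Suc t]) i = r t)))"

definition cop_number :: "'a pair_pre_digraph \<Rightarrow> nat" where
  "cop_number G = (LEAST k. cops_win G k)"

end

theory Submission
  imports Defs "HOL-Library.FuncSet" "HOL-Real_Asymp.Real_Asymp"
begin

text \<open>Up to logarithmic factors put \<open>L = n powr (3/7)\<close> and \<open>k = n powr (4/7) = n / L\<close>, and write
  \<open>r 0, r 1, \<dots>\<close> for the robber's vertices. A random guard of \<open>k\<close> cops is adjacent to every vertex of
  degree above \<open>L\<close>, so the robber stays in a set \<open>R\<close> of vertices of degree at most \<open>L\<close>. By Hall's
  theorem, \<open>k\<close> further random cops catch him within two moves unless he moves from \<open>v\<close> into a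
  set \<open>A v\<close> of neighbours whose ball of radius 2 has at most \<open>L * card (A v) \<le> L\<^sup>2\<close> vertices. Hence
  \<open>r 3\<close> lies in a set \<open>S\<close> of at most \<open>L\<^sup>2\<close> vertices determined by \<open>r 0\<close>. As the diameter is at
  most 3, \<open>k\<close> cops can occupy any \<open>k\<close> vertices chosen at time 0 before \<open>r 3\<close> is played; choosing
  them at random among the candidates for \<open>r 2\<close> makes every vertex of \<open>S\<close> with many neighbours
  among these candidates lethal, which leaves only about \<open>L\<^sup>2 / k\<close> choices of \<open>r 3\<close> for given \<open>r 2\<close>.
  The same holds for \<open>r 4\<close>, one step later. So at time 2 there are about \<open>(L\<^sup>2 / k)\<^sup>2 = k\<close> candidates
  for \<open>r 4\<close>, and \<open>k\<close> last cops reach all of them in three moves.\<close>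

section \<open>Random samples hitting prescribed sets\<close>

text \<open>First-moment argument for a uniform \<open>f\<close>: if every \<open>f\<close> failed
  for some \<open>j\<close>, the sum over \<open>J\<close> of 2 to the power (\<open>a j\<close>
  minus the number of hits of \<open>B j\<close>) would be at least 1 for every \<open>f\<close>,
  hence on average. By independence of the \<open>m\<close> coordinates the average is the left side
  of \<open>small\<close>: each coordinate contributes the factor
  \<open>1 - card (B j) / (2 * card X)\<close>.\<close>

lemma exists_sample_hitting:
  fixes B :: "'j \<Rightarrow> 'a set" and a :: "'j \<Rightarrow> nat"
  assumes fin: "finite X" "X \<noteq> {}" and J: "finite J" and B: "\<And>j. j \<in> J \<Longrightarrow> B j \<subseteq> X"
    and small: "(\<Sum>j\<in>J. 2 ^ a j * (1 - card (B j) / (2 * real (card X))) ^ m) < (1::real)"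
  shows "\<exists>f \<in> {..<m} \<rightarrow> X. \<forall>j\<in>J. a j \<le> card {i. i < m \<and> f i \<in> B j}"
proof (rule ccontr)
  assume contra: "\<not> ?thesis"
  let ?F = "{..<m} \<rightarrow>\<^sub>E X"
  let ?h = "\<lambda>f j. card {i. i < m \<and> f i \<in> B j}"
  define \<phi> :: "'a set \<Rightarrow> 'a \<Rightarrow> real" where "\<phi> b x = (if x \<in> b then 1 / 2 else 1)" for b x
  have finF: "finite ?F" using fin by (simp add: finite_PiE)
  have cardX: "0 < card X" using fin by (simp add: card_gt_0_iff)
  have prod: "(\<Prod>i<m. \<phi> (B j) (f i)) = (1 / 2) ^ ?h f j" for f j
  proof -
    have "(\<Prod>i<m. \<phi> (B j) (f i)) = (\<Prod>i\<in>{i. i < m \<and> f i \<in> B j}. 1 / 2)"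
      unfolding \<phi>_def
      by (subst prod.inter_filter[symmetric]) (auto simp: prod.If_cases Int_def lessThan_def)
    then show ?thesis by simp
  qed
  have weight: "(\<Sum>x\<in>X. \<phi> (B j) x) = card X * (1 - card (B j) / (2 * real (card X)))" if "j \<in> J" for j
  proof -
    have "(\<Sum>x\<in>X. \<phi> (B j) x) = (\<Sum>x\<in>X. 1 - (if x \<in> B j then 1 / 2 else 0))"
      unfolding \<phi>_def by (intro sum.cong) auto
    also have "\<dots> = card X - card (B j) / 2"
      using fin B[OF that] by (simp add: sum_subtractf sum.inter_restrict[symmetric] Int_absorb1)
    finally show ?thesis using cardX by (simp add: right_diff_distrib)
  qed
  have moment: "(\<Sum>f\<in>?F. (1 / 2) ^ ?h f j) = real (card X) ^ m * (1 - card (B j) / (2 * real (card X))) ^ m"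
    if "j \<in> J" for j
  proof -
    have "(\<Sum>f\<in>?F. (1 / 2) ^ ?h f j) = (\<Prod>i<m. \<Sum>x\<in>X. \<phi> (B j) x)"
      unfolding prod[symmetric] by (subst prod_sum_PiE) (use fin in auto)
    then show ?thesis by (simp add: weight[OF that] power_mult_distrib)
  qed
  have one: "1 \<le> (\<Sum>j\<in>J. 2 ^ a j * (1 / 2 :: real) ^ ?h f j)" if f: "f \<in> ?F" for f
  proof -
    obtain j where j: "j \<in> J" "?h f j < a j"
      using contra f by (force simp: not_le PiE_def)
    have "(1::real) \<le> 2 ^ a j * (1 / 2) ^ ?h f j"
      using j(2) by (simp add: power_one_over field_simps power_increasing)
    also have "\<dots> \<le> (\<Sum>j\<in>J. 2 ^ a j * (1 / 2 :: real) ^ ?h f j)"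
      using j(1) J by (intro member_le_sum) auto
    finally show ?thesis .
  qed
  have "real (card X) ^ m = (\<Sum>f\<in>?F. 1)"
    using fin by (simp add: card_PiE)
  also have "\<dots> \<le> (\<Sum>f\<in>?F. \<Sum>j\<in>J. 2 ^ a j * (1 / 2 :: real) ^ ?h f j)"
    using one by (rule sum_mono)
  also have "\<dots> = (\<Sum>j\<in>J. 2 ^ a j * (\<Sum>f\<in>?F. (1 / 2 :: real) ^ ?h f j))"
    by (subst sum.swap) (simp add: sum_distrib_left)
  also have "\<dots> = (\<Sum>j\<in>J. real (card X) ^ m * (2 ^ a j * (1 - card (B j) / (2 * real (card X))) ^ m))"
    by (intro sum.cong refl) (subst moment, simp_all add: mult_ac)
  also have "\<dots> = real (card X) ^ m * (\<Sum>j\<in>J. 2 ^ a j * (1 - card (B j) / (2 * real (card X))) ^ m)"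
    by (simp add: sum_distrib_left)
  also have "\<dots> < real (card X) ^ m * 1"
    using small cardX by (intro mult_strict_left_mono) auto
  finally show False by simp
qed

lemma half_miss_power_le:
  fixes b N c :: real
  assumes "0 < N" "0 \<le> b" "b \<le> N" and c: "2 * c * N \<le> b * real k"
  shows "(1 - b / (2 * N)) ^ k \<le> exp (- c)"
proof -
  have "(1 - b / (2 * N)) ^ k \<le> exp (- (b / (2 * N))) ^ k"
    using assms exp_ge_add_one_self[of "- (b / (2 * N))"] by (intro power_mono) (auto simp: field_simps)
  also have "\<dots> = exp (- (real k * (b / (2 * N))))" by (simp add: exp_of_nat_mult[symmetric])
  also have "\<dots> \<le> exp (- c)" using assms by (simp add: field_simps)
  finally show ?thesis .
qed

lemma sum_power_card_Pow:
  fixes x :: real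
  assumes "finite V"
  shows "(\<Sum>A\<in>Pow V. x ^ card A) = (1 + x) ^ card V"
  using prod_add[OF assms, of "\<lambda>_. x" "\<lambda>_. 1"] by (simp add: add.commute)

text \<open>One sample serves all sets \<open>A\<close> at once. The constant 6 makes the failure
  term of \<open>A\<close> at most \<open>(2 / n ^ 3) ^ card A\<close>, hence at most
  \<open>(1 / n ^ 2) ^ card A\<close>; over all nonempty \<open>A\<close> these bounds add up to
  \<open>(1 + 1 / n ^ 2) ^ n - 1\<close>, which is below 1.\<close>

lemma exists_sample_proportional:
  fixes V :: "'a set" and D :: "'a set \<Rightarrow> 'a set" and L :: real
  assumes V: "finite V" "2 \<le> card V" and D: "\<And>A. A \<subseteq> V \<Longrightarrow> D A \<subseteq> V"
    and L: "0 < L" and m: "6 * real (card V) * ln (card V) \<le> L * real m"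
  shows "\<exists>f \<in> {..<m} \<rightarrow> V. \<forall>A. A \<subseteq> V \<longrightarrow> A \<noteq> {} \<longrightarrow> L * card A \<le> card (D A) \<longrightarrow>
           card A \<le> card {i. i < m \<and> f i \<in> D A}"
proof -
  define n where "n = card V"
  define J where "J = {A. A \<subseteq> V \<and> A \<noteq> {} \<and> L * card A \<le> card (D A)}"
  have finJ: "finite J" using V by (auto simp: J_def)
  have n: "2 \<le> n" using V n_def by simp
  have bound: "2 ^ card A * (1 - card (D A) / (2 * real (card V))) ^ m \<le> (1 / real n ^ 2) ^ card A" if "A \<in> J" for A
  proof -
    have A: "A \<subseteq> V" "L * card A \<le> card (D A)" using that by (auto simp: J_def)
    have "(1 - card (D A) / (2 * real (card V))) ^ m \<le> exp (- (3 * real (card A) * ln n))"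
    proof (rule half_miss_power_le)
      show "0 < real (card V)" using V by simp
      show "real (card (D A)) \<le> real (card V)" using D[OF A(1)] V by (simp add: card_mono)
      have "2 * (3 * real (card A) * ln n) * card V = card A * (6 * real (card V) * ln (card V))"
        by (simp add: n_def)
      also have "\<dots> \<le> card A * (L * m)" using m by (intro mult_left_mono) auto
      also have "\<dots> = (L * card A) * m" by simp
      also have "\<dots> \<le> real (card (D A)) * m" using A(2) by (intro mult_right_mono) auto
      finally show "2 * (3 * real (card A) * ln n) * card V \<le> card (D A) * real m" .
    qed auto
    also have "\<dots> = (1 / real n ^ 3) ^ card A"
    proof -
      have "exp (- (3 * real (card A) * ln n)) = exp (- (3 * ln n)) ^ card A"
        by (simp add: exp_of_nat_mult[symmetric] mult_ac)
      also have "exp (- (3 * ln n)) = 1 / real n ^ 3"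
        using n by (simp add: exp_minus inverse_eq_divide exp_of_nat_mult[of 3, simplified])
      finally show ?thesis .
    qed
    finally have "2 ^ card A * (1 - card (D A) / (2 * real (card V))) ^ m \<le> 2 ^ card A * (1 / real n ^ 3) ^ card A"
      by simp
    also have "\<dots> = (2 / real n ^ 3) ^ card A" by (simp add: power_mult_distrib[symmetric])
    also have "\<dots> \<le> (1 / real n ^ 2) ^ card A"
      using n by (intro power_mono) (auto simp: field_simps power2_eq_square power3_eq_cube)
    finally show ?thesis .
  qed
  have "(\<Sum>A\<in>J. 2 ^ card A * (1 - card (D A) / (2 * real (card V))) ^ m) \<le> (\<Sum>A\<in>J. (1 / real n ^ 2) ^ card A)"
    using bound by (rule sum_mono)
  also have "\<dots> \<le> (\<Sum>A\<in>Pow V - {{}}. (1 / real n ^ 2) ^ card A)"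
    using V by (intro sum_mono2) (auto simp: J_def)
  also have "\<dots> = (1 + 1 / real n ^ 2) ^ n - 1"
    using V by (simp add: sum_diff1 sum_power_card_Pow n_def)
  also have "\<dots> \<le> exp (1 / real n ^ 2) ^ n - 1"
    using exp_ge_add_one_self[of "1 / real n ^ 2"] by (simp add: power_mono)
  also have "\<dots> = exp (1 / real n) - 1"
    using n by (simp add: exp_of_nat_mult[symmetric] power2_eq_square)
  also have "\<dots> \<le> exp (1 / 2) - 1" using n by (simp add: field_simps)
  also have "\<dots> < 1"
  proof -
    \<comment> \<open>Squaring reduces \<open>exp (1/2) < 2\<close> to
      \<open>exp 1 < 4\<close>.\<close>
    have "exp (1/2) ^ 2 < (2::real) ^ 2"
      using exp_le by (simp flip: exp_double)
    then show ?thesis using power_less_imp_less_base[of "exp (1/2)" 2 "2::real"] by simp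
  qed
  finally obtain f where "f \<in> {..<m} \<rightarrow> V" "\<forall>A\<in>J. card A \<le> card {i. i < m \<and> f i \<in> D A}"
    using exists_sample_hitting[of V J D card m] V finJ D by (force simp: J_def)
  then show ?thesis unfolding J_def by blast
qed

section \<open>Hall's marriage theorem\<close>

text \<open>Rado's proof: elements are deleted from sets with at least two elements, keeping Hall's
  condition, until all sets are singletons. If neither \<open>x\<close> nor \<open>y\<close> can be
  deleted from \<open>S i\<close>, the two violating index sets contradict Hall's condition by
  inclusion-exclusion.\<close>

lemma hall_marriage:
  fixes S :: "'i \<Rightarrow> 'b set"
  assumes "finite I" "\<And>i. i \<in> I \<Longrightarrow> finite (S i)"
    and "\<And>J. J \<subseteq> I \<Longrightarrow> card J \<le> card (\<Union>(S ` J))"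
  shows "\<exists>g. inj_on g I \<and> (\<forall>i\<in>I. g i \<in> S i)"
  using assms(2,3)
proof (induction "\<Sum>i\<in>I. card (S i)" arbitrary: S rule: less_induct)
  case less
  note finS = less.prems(1) and hall = less.prems(2)
  show ?case
  proof (cases "\<exists>i\<in>I. \<exists>x\<in>S i. \<exists>y\<in>S i. x \<noteq> y")
    case False
    have ne: "S i \<noteq> {}" if "i \<in> I" for i using hall[of "{i}"] that by auto
    define g where "g i = (SOME x. x \<in> S i)" for i
    have g: "g i \<in> S i" if "i \<in> I" for i using ne[OF that] by (auto simp: g_def intro: someI)
    have sing: "S i = {g i}" if "i \<in> I" for i using g[OF that] False that by blast
    have "inj_on g I"
    proof (rule inj_onI, rule ccontr)
      fix i j assume ij: "i \<in> I" "j \<in> I" "g i = g j" "i \<noteq> j"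
      then have "card (\<Union>(S ` {i, j})) = 1" by (simp add: sing)
      then show False using hall[of "{i, j}"] ij by simp
    qed
    then show ?thesis using g by blast
  next
    case True
    then obtain i x y where i: "i \<in> I" and xy: "x \<in> S i" "y \<in> S i" "x \<noteq> y" by blast
    define R where "R z = S(i := S i - {z})" for z
    have smaller: "(\<Sum>j\<in>I. card (R z j)) < (\<Sum>j\<in>I. card (S j))" if "z \<in> S i" for z
    proof (rule sum_strict_mono_ex1)
      show "\<forall>j\<in>I. card (R z j) \<le> card (S j)"
        using finS by (auto simp: R_def card_mono)
      show "\<exists>j\<in>I. card (R z j) < card (S j)"
        using i that finS by (intro bexI[of _ i]) (auto simp: R_def simp del: card_Diff_insert intro!: card_Diff1_less)
    qed (rule assms(1))
    have finR: "finite (R z j)" if "j \<in> I" for z j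
      using finS that i by (auto simp: R_def)
    have reduce: ?thesis if z: "z \<in> S i" and hz: "\<And>J. J \<subseteq> I \<Longrightarrow> card J \<le> card (\<Union>(R z ` J))" for z
    proof -
      obtain g where "inj_on g I" "\<forall>j\<in>I. g j \<in> R z j"
        using less.hyps[OF smaller[OF z] finR hz] by blast
      moreover have "R z j \<subseteq> S j" for j by (auto simp: R_def)
      ultimately show ?thesis by blast
    qed
    \<comment> \<open>A violating index set must contain \<open>i\<close>; dropping \<open>i\<close>
      from it turns the strict inequality into \<open>\<le>\<close>.\<close>
    have violation: "\<exists>K\<subseteq>I - {i}. card (\<Union>(S ` K) \<union> (S i - {z})) \<le> card K"
      if "J \<subseteq> I" "\<not> card J \<le> card (\<Union>(R z ` J))" for J z
    proof (cases "i \<in> J")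
      case False
      then have "R z ` J = S ` J" by (auto simp: R_def intro!: image_cong)
      then show ?thesis using hall[OF that(1)] that(2) by simp
    next
      case True
      have "\<Union>(R z ` J) = \<Union>(S ` (J - {i})) \<union> (S i - {z})"
        using True by (auto simp: R_def split: if_splits)
      moreover have "card J = Suc (card (J - {i}))"
        using True that(1) assms(1) by (metis card.remove finite_subset)
      ultimately show ?thesis using that by (intro exI[of _ "J - {i}"]) auto
    qed
    show ?thesis
    proof (rule ccontr)
      assume contra: "\<not> ?thesis"
      obtain J where J: "J \<subseteq> I - {i}" "card (\<Union>(S ` J) \<union> (S i - {x})) \<le> card J"
        using reduce[OF xy(1)] violation contra by meson
      obtain K where K: "K \<subseteq> I - {i}" "card (\<Union>(S ` K) \<union> (S i - {y})) \<le> card K"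
        using reduce[OF xy(2)] violation contra by meson
      let ?X = "\<Union>(S ` J) \<union> (S i - {x})" and ?Y = "\<Union>(S ` K) \<union> (S i - {y})"
      have finJK: "finite J" "finite K" using J K assms(1) by (auto dest: finite_subset)
      have finXY: "finite ?X" "finite ?Y" using J K finJK finS i by auto
      \<comment> \<open>As \<open>x \<noteq> y\<close>, the set \<open>?X \<union> ?Y\<close>
        contains all of \<open>S i\<close>, so \<open>i\<close> can be added to the indices; this
        surplus of 1 yields the contradiction.\<close>
      have "card (insert i (J \<union> K)) \<le> card (\<Union>(S ` insert i (J \<union> K)))"
        using J K i by (intro hall) auto
      also have "\<dots> \<le> card (?X \<union> ?Y)"
        using xy finXY by (intro card_mono) auto
      finally have "Suc (card (J \<union> K)) \<le> card (?X \<union> ?Y)"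
        using J K finJK by (subst (asm) card_insert_disjoint) auto
      moreover have "card (J \<inter> K) \<le> card (?X \<inter> ?Y)"
      proof -
        have "card (J \<inter> K) \<le> card (\<Union>(S ` (J \<inter> K)))" using J by (intro hall) auto
        also have "\<dots> \<le> card (?X \<inter> ?Y)" using finXY by (intro card_mono) auto
        finally show ?thesis .
      qed
      moreover have "card ?X + card ?Y = card (?X \<union> ?Y) + card (?X \<inter> ?Y)"
        by (rule card_Un_Int[OF finXY])
      moreover have "card J + card K = card (J \<union> K) + card (J \<inter> K)"
        by (rule card_Un_Int[OF finJK])
      ultimately show False using J(2) K(2) by linarith
    qed
  qed
qed

section \<open>Blocking sets and matchings in reflexive graphs\<close>

text \<open>\<open>M\<close> stands for "stay or step along an edge", so walks with exactly
  \<open>j\<close> steps cover all shorter ones.\<close>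

locale reflexive_graph =
  fixes V :: "'a set" and M :: "'a \<Rightarrow> 'a \<Rightarrow> bool"
  assumes finite_V: "finite V" and M_sym: "M u v \<Longrightarrow> M v u" and M_refl: "M u u"
    and M_closed: "u \<in> V \<Longrightarrow> M u v \<Longrightarrow> v \<in> V"
begin

text \<open>By reflexivity this is a closed neighbourhood, and \<open>nbhd (nbhd A)\<close> is the
  ball of radius 2 around \<open>A\<close>.\<close>

definition nbhd :: "'a set \<Rightarrow> 'a set" where
  "nbhd A = {v. \<exists>u\<in>A. M u v}"

lemma nbhd_subset: "A \<subseteq> V \<Longrightarrow> nbhd A \<subseteq> V"
  by (auto simp: nbhd_def M_closed)

lemma nbhd_mono: "A \<subseteq> B \<Longrightarrow> nbhd A \<subseteq> nbhd B"
  by (auto simp: nbhd_def)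

lemma nbhd_Un: "nbhd (A \<union> B) = nbhd A \<union> nbhd B"
  by (auto simp: nbhd_def)

text \<open>A random k-element sample of \<open>W\<close> is adjacent to every \<open>y \<in> S\<close> with many neighbours
  in \<open>W\<close>. Few edges lead from \<open>W\<close> to the other \<open>y\<close>, so half of the vertices of \<open>W\<close> see few
  of them; the other half is treated recursively.\<close>

lemma exists_blocking_set:
  assumes V: "2 \<le> card V" and S: "S \<subseteq> V" and k: "0 < k"
  shows "W \<subseteq> V \<Longrightarrow> card W < 2 ^ t \<Longrightarrow>
    \<exists>P\<subseteq>V. card P \<le> k * t \<and>
      (\<forall>w\<in>W. card {y\<in>S. M w y \<and> y \<notin> nbhd P} \<le> 12 * real (card S) * ln (card V) / k)"
proof (induction t arbitrary: W)
  case 0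
  then have "W = {}" using finite_V by (auto dest: finite_subset)
  then show ?case by (intro exI[of _ "{}"]) auto
next
  case (Suc t)
  define n where "n = card V"
  define d where "d = 12 * real (card S) * ln (card V) / k"
  have fin: "finite W" "finite S" using Suc.prems S finite_V by (auto dest: finite_subset)
  have n: "2 \<le> n" using V n_def by simp
  have lnV: "0 < ln (real (card V))" using V by (intro ln_gt_zero) linarith
  show ?case
  proof (cases "W = {}")
    case True
    then show ?thesis by (intro exI[of _ "{}"]) auto
  next
    case False
    then have cW: "0 < card W" using fin by (simp add: card_gt_0_iff)
    \<comment> \<open>These \<open>y\<close> see so large a share of \<open>W\<close> that the
      failure term of each is at most \<open>2 / n ^ 3\<close>; one sample therefore hits the
      neighbourhoods of all of them.\<close>
    define J where "J = {y\<in>S. 6 * ln n * card W \<le> real (card {w\<in>W. M w y}) * k}"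
    have J: "J \<subseteq> S" by (auto simp: J_def)
    have bound: "2 ^ 1 * (1 - card {w\<in>W. M w y} / (2 * real (card W))) ^ k \<le> 2 * (1 / real n ^ 3)"
      if "y \<in> J" for y
    proof -
      have "(1 - card {w\<in>W. M w y} / (2 * real (card W))) ^ k \<le> exp (- (3 * ln n))"
        using that cW fin by (intro half_miss_power_le) (auto simp: J_def intro: card_mono)
      also have "\<dots> = 1 / real n ^ 3"
        using n by (simp add: exp_minus inverse_eq_divide exp_of_nat_mult[of 3, simplified])
      finally show ?thesis by simp
    qed
    have "(\<Sum>y\<in>J. 2 ^ 1 * (1 - card {w\<in>W. M w y} / (2 * real (card W))) ^ k)
        \<le> real (card J) * (2 * (1 / real n ^ 3))"
      using sum_mono[OF bound] by simp
    also have "\<dots> \<le> real n * (2 * (1 / real n ^ 3))"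
      using card_mono[OF finite_V, of J] J S by (intro mult_right_mono) (auto simp: n_def)
    also have "\<dots> = 2 / real n ^ 2" using n by (simp add: field_simps power2_eq_square power3_eq_cube)
    also have "\<dots> < 1"
    proof -
      have "2 * 2 \<le> real n * real n" using n by (intro mult_mono) auto
      then show ?thesis using n by (simp add: power2_eq_square field_simps)
    qed
    finally obtain f where f: "f \<in> {..<k} \<rightarrow> W"
      "\<forall>y\<in>J. 1 \<le> card {i. i < k \<and> f i \<in> {w\<in>W. M w y}}"
      using exists_sample_hitting[of W J "\<lambda>y. {w\<in>W. M w y}" "\<lambda>_. 1" k]
        fin False finite_subset[OF J] by blast
    define P where "P = f ` {..<k}"
    have P: "P \<subseteq> V" "card P \<le> k"
      using f(1) Suc.prems(1) card_image_le[of "{..<k}" f] by (auto simp: P_def)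
    define S' where "S' = {y\<in>S. y \<notin> nbhd P}"
    have S': "real (card {w\<in>W. M w y}) \<le> 6 * ln n * card W / k" if "y \<in> S'" for y
    proof -
      have "y \<notin> J"
      proof
        assume "y \<in> J"
        then have "{i. i < k \<and> f i \<in> {w\<in>W. M w y}} \<noteq> {}"
          using f(2) by (metis card.empty not_one_le_zero)
        then show False using that by (auto simp: S'_def nbhd_def P_def)
      qed
      then show ?thesis using that k by (auto simp: J_def S'_def field_simps)
    qed
    \<comment> \<open>Double counting: at most \<open>card W * d / 2\<close> pairs join
      \<open>W\<close> to \<open>S'\<close>, so at most half of \<open>W\<close> exceeds
      \<open>d\<close>. This halving is why \<open>d\<close> has 12 where \<open>J\<close> has
      6.\<close>
    define W' where "W' = {w\<in>W. d < card {y\<in>S'. M w y}}"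
    have W'W: "W' \<subseteq> W" by (auto simp: W'_def)
    have fin': "finite S'" "finite W'" "card S' \<le> card S" using fin by (auto simp: S'_def W'_def intro: card_mono)
    have "card W' * d \<le> (\<Sum>w\<in>W'. real (card {y\<in>S'. M w y}))"
      using sum_mono[of W' "\<lambda>_. d" "\<lambda>w. real (card {y\<in>S'. M w y})"] by (auto simp: W'_def)
    also have "\<dots> \<le> (\<Sum>w\<in>W. real (card {y\<in>S'. M w y}))"
      using fin by (intro sum_mono2) (auto simp: W'_def)
    also have "\<dots> = (\<Sum>w\<in>W. \<Sum>y\<in>S'. if M w y then 1 else 0)"
      using fin' by (simp add: sum.inter_filter[symmetric])
    also have "\<dots> = (\<Sum>y\<in>S'. real (card {w\<in>W. M w y}))"
      using fin by (subst sum.swap) (simp add: sum.inter_filter[symmetric])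
    also have "\<dots> \<le> real (card S') * (6 * ln n * card W / k)"
      using sum_mono[OF S'] by simp
    also have "\<dots> \<le> real (card S) * (6 * ln n * card W / k)"
      using fin'(3) n by (intro mult_right_mono) auto
    also have "\<dots> = card W * d / 2" by (simp add: d_def n_def)
    finally have count: "card W' * d \<le> card W * d / 2" .
    have "card W' < 2 ^ t"
    \<comment> \<open>For empty \<open>S\<close> the threshold \<open>d\<close> is 0 and cannot be
      cancelled from \<open>count\<close>.\<close>
    proof (cases "S = {}")
      case True
      then have "W' = {}" by (auto simp: W'_def S'_def d_def)
      then show ?thesis by simp
    next
      case False
      then have "0 < d" using fin lnV k unfolding d_def
        by (intro divide_pos_pos mult_pos_pos) (auto simp: card_gt_0_iff)
      then have "2 * real (card W') \<le> card W" using count by (simp add: field_simps)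
      then show ?thesis using Suc.prems(2) by simp
    qed
    then obtain Q where Q: "Q \<subseteq> V" "card Q \<le> k * t"
      "\<forall>w\<in>W'. card {y\<in>S. M w y \<and> y \<notin> nbhd Q} \<le> d"
      using Suc.IH[of W'] Suc.prems(1) W'W unfolding d_def by blast
    have "card {y\<in>S. M w y \<and> y \<notin> nbhd (P \<union> Q)} \<le> d" if "w \<in> W" for w
    proof (cases "w \<in> W'")
      case True
      have "card {y\<in>S. M w y \<and> y \<notin> nbhd (P \<union> Q)} \<le> card {y\<in>S. M w y \<and> y \<notin> nbhd Q}"
        using fin by (intro card_mono) (auto simp: nbhd_Un)
      then show ?thesis using Q(3) True by (meson of_nat_le_iff order_trans)
    next
      case False
      have "card {y\<in>S. M w y \<and> y \<notin> nbhd (P \<union> Q)} \<le> card {y\<in>S'. M w y}"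
        using fin by (intro card_mono) (auto simp: nbhd_Un S'_def)
      then show ?thesis using False that by (simp add: W'_def)
    qed
    moreover have "card (P \<union> Q) \<le> k * Suc t"
      using card_Un_le[of P Q] P Q by simp
    ultimately show ?thesis using P Q unfolding d_def by (intro exI[of _ "P \<union> Q"]) auto
  qed
qed

text \<open>\<open>A\<close> is a largest subset of \<open>N\<close> whose ball of radius 2 has at
  most \<open>L * card A\<close> vertices. For \<open>T\<close> disjoint from \<open>A\<close>,
  maximality forces the ball of \<open>T\<close> above \<open>L * card T\<close>, so
  \<open>f\<close> hits it \<open>card T\<close> times. This is Hall's condition for giving each
  vertex of \<open>N - A\<close> its own cop at most two moves away.\<close>

lemma exists_hall_violator:
  fixes f :: "nat \<Rightarrow> 'a" and L :: real
  assumes f: "\<And>A. A \<subseteq> V \<Longrightarrow> A \<noteq> {} \<Longrightarrow> L * card A \<le> card (nbhd (nbhd A)) \<Longrightarrow>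
           card A \<le> card {i. i < m \<and> f i \<in> nbhd (nbhd A)}"
    and N: "N \<subseteq> V"
  shows "\<exists>A g. A \<subseteq> N \<and> card (nbhd (nbhd A)) \<le> L * card A \<and>
    (\<forall>i<m. \<exists>y. M (f i) y \<and> M y (g i)) \<and> (\<forall>u\<in>N - A. \<exists>i<m. g i = u)"
proof -
  define \<A> where "\<A> = {A. A \<subseteq> N \<and> card (nbhd (nbhd A)) \<le> L * card A}"
  have finN: "finite N" using N finite_V by (rule finite_subset)
  have fam: "finite \<A>" "{} \<in> \<A>" using finN by (auto simp: \<A>_def nbhd_def)
  then have "Max (card ` \<A>) \<in> card ` \<A>" by (intro Max_in) auto
  then obtain A where A: "A \<in> \<A>" and cA: "card A = Max (card ` \<A>)" by auto
  have max: "card B \<le> card A" if "B \<in> \<A>" for B using fam that by (simp add: cA)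
  have AN: "A \<subseteq> N" using A by (simp add: \<A>_def)
  have finA: "finite A" using AN finN by (rule finite_subset)
  have hits: "card T \<le> card {i. i < m \<and> f i \<in> nbhd (nbhd T)}" if T: "T \<subseteq> N - A" for T
  proof (cases "T = {}")
    case False
    have finT: "finite T" using T finN by (auto dest: finite_subset)
    have "card A < card (A \<union> T)"
      using T False finA finT by (subst card_Un_disjoint) (auto simp: card_gt_0_iff)
    then have "A \<union> T \<notin> \<A>" using max[of "A \<union> T"] by linarith
    then have "L * card (A \<union> T) < card (nbhd (nbhd (A \<union> T)))" using T AN by (auto simp: \<A>_def)
    also have "\<dots> \<le> real (card (nbhd (nbhd A))) + card (nbhd (nbhd T))"
      using card_Un_le[of "nbhd (nbhd A)" "nbhd (nbhd T)"] by (simp add: nbhd_Un)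
    also have "\<dots> \<le> L * card A + card (nbhd (nbhd T))" using A by (simp add: \<A>_def)
    also have "card (A \<union> T) = card A + card T"
      using T finA finT by (subst card_Un_disjoint) auto
    finally have "L * card T \<le> card (nbhd (nbhd T))" by (simp add: algebra_simps)
    then show ?thesis using f[of T] T N False by auto
  qed simp
  have "\<exists>h. inj_on h (N - A) \<and> (\<forall>u\<in>N - A. h u \<in> {i. i < m \<and> f i \<in> nbhd (nbhd {u})})"
  proof (rule hall_marriage)
    fix T assume T: "T \<subseteq> N - A"
    have "(\<Union>u\<in>T. {i. i < m \<and> f i \<in> nbhd (nbhd {u})}) = {i. i < m \<and> f i \<in> nbhd (nbhd T)}"
      by (auto simp: nbhd_def)
    then show "card T \<le> card (\<Union>u\<in>T. {i. i < m \<and> f i \<in> nbhd (nbhd {u})})"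
      using hits[OF T] by simp
  qed (use finN in auto)
  then obtain h where h: "inj_on h (N - A)" "\<And>u. u \<in> N - A \<Longrightarrow> h u < m \<and> f (h u) \<in> nbhd (nbhd {u})"
    by blast
  \<comment> \<open>Unmatched cops take their own vertex as target, so every target is within two
    moves.\<close>
  define g where "g i = (if i \<in> h ` (N - A) then the_inv_into (N - A) h i else f i)" for i
  have g: "g (h u) = u" if "u \<in> N - A" for u
    using that h(1) by (auto simp: g_def the_inv_into_f_f)
  have "\<exists>y. M (f i) y \<and> M y (g i)" for i
  proof (cases "i \<in> h ` (N - A)")
    case True
    then obtain u where "u \<in> N - A" "i = h u" by blast
    then show ?thesis using h(2)[of u] g[of u] M_sym by (auto simp: nbhd_def)
  next
    case False
    then show ?thesis using M_refl by (auto simp: g_def)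
  qed
  moreover have "\<forall>u\<in>N - A. \<exists>i<m. g i = u" using g h(2) by blast
  ultimately show ?thesis using A by (intro exI[of _ A] exI[of _ g]) (simp add: \<A>_def)
qed


section \<open>Strategies that follow a walk and catch on sight\<close>

text \<open>The history is newest first, so that primitive recursion peels off the latest robber
  vertex.\<close>

primrec chase_rev :: "'a \<Rightarrow> ('a list \<Rightarrow> 'a) \<Rightarrow> 'a list \<Rightarrow> 'a" where
  "chase_rev h plan [] = h"
| "chase_rev h plan (x # xs) =
    (let c = chase_rev h plan xs; p = plan (rev (x # xs))
     in if M c x then x else if M c p then p else c)"

text \<open>A cop that takes the robber whenever it can and otherwise follows \<open>plan\<close>, which sees the
  robber's vertices so far; steps of the plan that are not moves are ignored, so this is a
  legal strategy for every plan.\<close>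

definition chase :: "'a \<Rightarrow> ('a list \<Rightarrow> 'a) \<Rightarrow> 'a list \<Rightarrow> 'a" where
  "chase h plan hs = chase_rev h plan (rev hs)"

lemma chase_Nil [simp]: "chase h plan [] = h"
  by (simp add: chase_def)

lemma chase_snoc: "chase h plan (hs @ [x]) =
    (if M (chase h plan hs) x then x
     else if M (chase h plan hs) (plan (hs @ [x])) then plan (hs @ [x]) else chase h plan hs)"
  by (simp add: chase_def Let_def)

lemma chase_move: "M (chase h plan hs) (chase h plan (hs @ [x]))"
  by (simp add: chase_snoc M_refl)

text \<open>The walk \<open>w\<close> is chosen from \<open>r 0, \<dots>, r \<tau>\<close> and started at time \<open>\<tau>\<close>; before that the truncated
  difference keeps the cop at \<open>w _ 0 = h\<close>.\<close>

definition launch :: "nat \<Rightarrow> 'a \<Rightarrow> ('a list \<Rightarrow> nat \<Rightarrow> 'a) \<Rightarrow> 'a list \<Rightarrow> 'a" where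
  "launch \<tau> h w = chase h (\<lambda>hs. w (take (Suc \<tau>) hs) (length hs - \<tau>))"

lemma launch_Nil [simp]: "launch \<tau> h w [] = h"
  by (simp add: launch_def)

lemma launch_move: "M (launch \<tau> h w hs) (launch \<tau> h w (hs @ [x]))"
  by (simp add: launch_def chase_move)

text \<open>A cop that never catches the robber was never able to on its turn, so it has followed
  its walk exactly; when \<open>r t\<close> is played it stands at offset
  \<open>t - \<tau>\<close>.\<close>

lemma launch_evaded:
  assumes w0: "\<And>hs. w hs 0 = h" and w: "\<And>hs j. M (w hs j) (w hs (Suc j))"
    and evade: "\<And>t. launch \<tau> h w (map r [0..<Suc t]) \<noteq> r t"
  shows "\<not> M (w (map r [0..<Suc \<tau>]) (t - \<tau>)) (r t)"
proof -
  have away: "\<not> M (launch \<tau> h w (map r [0..<t])) (r t)" for t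
    using evade[of t] by (auto simp: launch_def chase_snoc)
  have "launch \<tau> h w (map r [0..<t]) = w (map r [0..<Suc \<tau>]) (t - \<tau>)"
  proof (induction t)
    case 0
    then show ?case by (simp add: w0)
  next
    case (Suc t)
    \<comment> \<open>For \<open>t < \<tau>\<close> the histories may differ, but the offset is 0
      and both sides are \<open>h\<close>.\<close>
    have plan: "w (take (Suc \<tau>) (map r [0..<Suc t])) (Suc t - \<tau>) = w (map r [0..<Suc \<tau>]) (Suc t - \<tau>)"
    proof (cases "t < \<tau>")
      case True
      then show ?thesis by (simp add: w0)
    next
      case False
      then show ?thesis by (simp add: take_map del: upt_Suc)
    qed
    have "M (w (map r [0..<Suc \<tau>]) (t - \<tau>)) (w (map r [0..<Suc \<tau>]) (Suc t - \<tau>))"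
      using w by (cases "t < \<tau>") (simp_all add: M_refl Suc_diff_le w0 del: upt_Suc)
    then show ?case
      using away[of t] Suc.IH plan by (simp add: launch_def chase_snoc)
  qed
  then show ?thesis using away[of t] by simp
qed

text \<open>The size bound guards only the covering claim, so an enumeration exists for every
  \<open>X\<close> and can be chosen uniformly; surplus indices get a dummy vertex.\<close>

lemma exists_enumeration:
  assumes "X \<subseteq> V" "V \<noteq> {}"
  shows "\<exists>e. (\<forall>i. e i \<in> V) \<and> (card X \<le> q \<longrightarrow> X \<subseteq> e ` {..<q})"
proof -
  obtain v where v: "v \<in> V" using assms(2) by blast
  have "finite X" using assms(1) finite_V by (rule finite_subset)
  then obtain b where b: "bij_betw b {..<card X} X"
    using ex_bij_betw_nat_finite[of X] by (auto simp: atLeast0LessThan)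
  define e where "e i = (if i < card X then b i else v)" for i
  have "e i \<in> V" for i using b v assms(1) by (auto simp: e_def bij_betw_def)
  moreover have "X \<subseteq> e ` {..<q}" if "card X \<le> q"
  proof
    fix x assume "x \<in> X"
    then obtain i where "i < card X" "x = b i" using b by (auto simp: bij_betw_def)
    then show "x \<in> e ` {..<q}" using that by (auto simp: e_def image_iff intro!: bexI[of _ i])
  qed
  ultimately show ?thesis by blast
qed

section \<open>The winning team\<close>

text \<open>\<open>3 * m\<close> counts the guards and the matched teams launched at times 0 and 1,
  \<open>2 * (k * t)\<close> the blocking teams launched at these times, and the last summand the
  cops sent to the candidates for \<open>r 4\<close>.\<close>

theorem exists_winning_team:
  fixes L d :: real
  assumes V: "2 \<le> card V"
    and diam: "\<And>x y. x \<in> V \<Longrightarrow> y \<in> V \<Longrightarrow> \<exists>a b. M x a \<and> M a b \<and> M b y"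
    and L: "0 < L" and m: "6 * real (card V) * ln (card V) \<le> L * real m"
    and k: "0 < k" and t: "card V < 2 ^ t" and d: "d = 12 * L\<^sup>2 * ln (card V) / k"
  shows "\<exists>\<Sigma>. finite \<Sigma> \<and> card \<Sigma> \<le> 3 * m + 2 * (k * t) + nat \<lfloor>d\<^sup>2\<rfloor> \<and>
    (\<forall>\<sigma>\<in>\<Sigma>. \<sigma> [] \<in> V \<and> (\<forall>hs x. M (\<sigma> hs) (\<sigma> (hs @ [x])))) \<and>
    (\<forall>r. r 0 \<in> V \<longrightarrow> (\<forall>t. M (r t) (r (Suc t))) \<longrightarrow> (\<exists>t. \<exists>\<sigma>\<in>\<Sigma>. \<sigma> (map r [0..<Suc t]) = r t))"
proof -
  have V0: "V \<noteq> {}" using V by auto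
  then obtain v0 where v0: "v0 \<in> V" by blast
  have lnV: "0 < ln (real (card V))" using V by (intro ln_gt_zero) linarith
  obtain g where g: "g \<in> {..<m} \<rightarrow> V"
    "\<And>A. A \<subseteq> V \<Longrightarrow> A \<noteq> {} \<Longrightarrow> L * card A \<le> card (nbhd A) \<Longrightarrow> card A \<le> card {i. i < m \<and> g i \<in> nbhd A}"
    using exists_sample_proportional[OF finite_V V, of nbhd L m] nbhd_subset L m by blast
  have nbhd2: "nbhd (nbhd A) \<subseteq> V" if "A \<subseteq> V" for A using that nbhd_subset by blast
  obtain f where f: "f \<in> {..<m} \<rightarrow> V"
    "\<And>A. A \<subseteq> V \<Longrightarrow> A \<noteq> {} \<Longrightarrow> L * card A \<le> card (nbhd (nbhd A)) \<Longrightarrow>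
      card A \<le> card {i. i < m \<and> f i \<in> nbhd (nbhd A)}"
    using exists_sample_proportional[OF finite_V V, of "\<lambda>A. nbhd (nbhd A)" L m] nbhd2 L m by blast
  define R where "R = {v\<in>V. \<forall>i<m. \<not> M (g i) v}"
  have RV: "R \<subseteq> V" by (auto simp: R_def)
  \<comment> \<open>The sampling property of \<open>g\<close> for the singleton
    \<open>{v}\<close>.\<close>
  have degree: "card (nbhd {v}) \<le> L" if "v \<in> R" for v
  proof (rule ccontr)
    assume "\<not> ?thesis"
    then have "1 \<le> card {i. i < m \<and> g i \<in> nbhd {v}}" using g(2)[of "{v}"] that RV by auto
    then have "{i. i < m \<and> g i \<in> nbhd {v}} \<noteq> {}" by (metis card.empty not_one_le_zero)
    then show False using that M_sym by (auto simp: R_def nbhd_def)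
  qed
  have "\<forall>v. \<exists>A G. A \<subseteq> nbhd {v} \<inter> R \<and> card (nbhd (nbhd A)) \<le> L * card A \<and>
    (\<forall>i<m. \<exists>y. M (f i) y \<and> M y (G i)) \<and> (\<forall>u\<in>nbhd {v} \<inter> R - A. \<exists>i<m. G i = u)"
  proof
    fix v
    have "nbhd {v} \<inter> R \<subseteq> V" using RV by blast
    then show "\<exists>A G. A \<subseteq> nbhd {v} \<inter> R \<and> card (nbhd (nbhd A)) \<le> L * card A \<and>
      (\<forall>i<m. \<exists>y. M (f i) y \<and> M y (G i)) \<and> (\<forall>u\<in>nbhd {v} \<inter> R - A. \<exists>i<m. G i = u)"
      by (intro exists_hall_violator f(2))
  qed
  from choice[OF this] obtain A where
    "\<forall>v. \<exists>G. A v \<subseteq> nbhd {v} \<inter> R \<and> card (nbhd (nbhd (A v))) \<le> L * card (A v) \<and>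
      (\<forall>i<m. \<exists>y. M (f i) y \<and> M y (G i)) \<and> (\<forall>u\<in>nbhd {v} \<inter> R - A v. \<exists>i<m. G i = u)" ..
  from choice[OF this] obtain G where
    A: "\<And>v. A v \<subseteq> nbhd {v} \<inter> R" "\<And>v. card (nbhd (nbhd (A v))) \<le> L * card (A v)" and
    G: "\<And>v i. i < m \<Longrightarrow> \<exists>y. M (f i) y \<and> M y (G v i)"
      "\<And>v u. u \<in> nbhd {v} \<inter> R - A v \<Longrightarrow> \<exists>i<m. G v i = u" by blast
  \<comment> \<open>For a robber at \<open>v\<close> at time \<open>\<tau>\<close> in {0, 1},
    \<open>W v\<close> and \<open>S v\<close> contain the candidates for
    \<open>r (\<tau> + 2)\<close> and \<open>r (\<tau> + 3)\<close>.\<close>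
  define W where "W v = nbhd (A v) \<inter> R" for v
  define S where "S v = nbhd (W v) \<inter> R" for v
  have WS: "W v \<subseteq> V" "S v \<subseteq> V" for v using RV by (auto simp: W_def S_def)
  have cardS: "card (S v) \<le> L\<^sup>2" if "v \<in> R" for v
  proof -
    have AV: "A v \<subseteq> V" using A(1) RV by blast
    have "S v \<subseteq> nbhd (nbhd (A v))" using nbhd_mono[of "W v" "nbhd (A v)"] by (auto simp: S_def W_def)
    then have "card (S v) \<le> card (nbhd (nbhd (A v)))"
      using finite_subset[OF nbhd2[OF AV] finite_V] by (intro card_mono)
    also have "\<dots> \<le> L * card (A v)" by (rule A(2))
    also have "\<dots> \<le> L * card (nbhd {v})"
      using L A(1)[of v] finite_subset[OF nbhd_subset finite_V, of "{v}"] that RV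
      by (intro mult_left_mono) (auto intro!: card_mono)
    also have "\<dots> \<le> L * L" using degree[OF that] L by (intro mult_left_mono) auto
    finally show ?thesis by (simp add: power2_eq_square)
  qed
  have "\<forall>v. \<exists>P. P \<subseteq> V \<and> card P \<le> k * t \<and>
    (\<forall>w\<in>W v. card {y\<in>S v. M w y \<and> y \<notin> nbhd P} \<le> 12 * real (card (S v)) * ln (card V) / k)"
  proof
    fix v
    have "card (W v) < 2 ^ t" using card_mono[OF finite_V WS(1)] t by (rule order.strict_trans1)
    then show "\<exists>P. P \<subseteq> V \<and> card P \<le> k * t \<and>
      (\<forall>w\<in>W v. card {y\<in>S v. M w y \<and> y \<notin> nbhd P} \<le> 12 * real (card (S v)) * ln (card V) / k)"
      by (rule exists_blocking_set[OF V WS(2) k WS(1)])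
  qed
  from choice[OF this] obtain P where P: "\<And>v. P v \<subseteq> V" "\<And>v. card (P v) \<le> k * t" and
    P': "\<And>v w. w \<in> W v \<Longrightarrow>
      card {y\<in>S v. M w y \<and> y \<notin> nbhd (P v)} \<le> 12 * real (card (S v)) * ln (card V) / k" by blast
  define T where "T v w = {y\<in>S v. M w y \<and> y \<notin> nbhd (P v)}" for v w
  have TV: "T v w \<subseteq> V" for v w using WS by (auto simp: T_def)
  have cardT: "card (T v w) \<le> d" if "v \<in> R" "w \<in> W v" for v w
  proof -
    have "card (T v w) \<le> 12 * real (card (S v)) * ln (card V) / k" using P'[OF that(2)] by (simp add: T_def)
    also have "\<dots> \<le> d"
      unfolding d using cardS[OF that(1)] lnV k by (intro divide_right_mono mult_right_mono) auto
    finally show ?thesis .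
  qed
  \<comment> \<open>With \<open>v, u, w\<close> as \<open>r 0, r 1, r 2\<close>, the index
    \<open>y\<close> runs over the candidates for \<open>r 3\<close>, and \<open>T u y\<close>
    contains those for \<open>r 4\<close>.\<close>
  define Z where "Z v u w = (\<Union>y\<in>T v w. T u y)" for v u w
  define q where "q = nat \<lfloor>d\<^sup>2\<rfloor>"
  have "\<forall>v. \<exists>e. (\<forall>i. e i \<in> V) \<and> P v \<subseteq> e ` {..<k * t}"
    using exists_enumeration[OF P(1) V0] P(2) by blast
  from choice[OF this] obtain e where
    e: "\<And>v i. e v i \<in> V" "\<And>v. P v \<subseteq> e v ` {..<k * t}" by blast
  have ZV: "Z v u w \<subseteq> V" for v u w using TV by (auto simp: Z_def)
  obtain z where z: "\<And>v u w i. z v u w i \<in> V"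
    "\<And>v u w. card (Z v u w) \<le> q \<Longrightarrow> Z v u w \<subseteq> z v u w ` {..<q}"
    using exists_enumeration[OF ZV V0, of _ _ _ q] by metis
  \<comment> \<open>Diameter at most 3 lets all blocking and final cops wait at the single vertex
    \<open>v0\<close>; their walks rest at the target from offset 3 on.\<close>
  have "\<exists>w. w 0 = v0 \<and> (\<forall>j. M (w j) (w (Suc j))) \<and> w 3 = y" if y: "y \<in> V" for y
  proof -
    obtain a b where "M v0 a" "M a b" "M b y" using diam[OF v0 y] by blast
    then show ?thesis
      by (intro exI[of _ "\<lambda>j. if j = 0 then v0 else if j = 1 then a else if j = 2 then b else y"])
        (auto simp: M_refl)
  qed
  then obtain walk where walk: "\<And>y. y \<in> V \<Longrightarrow> walk y 0 = v0"
    "\<And>y j. y \<in> V \<Longrightarrow> M (walk y j) (walk y (Suc j))" "\<And>y. y \<in> V \<Longrightarrow> walk y 3 = y" by metis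
  have step_ex: "\<exists>w. w 0 = f i \<and> (\<forall>j. M (w j) (w (Suc j))) \<and> w 2 = G v i" if i: "i < m" for v i
  proof -
    obtain y where "M (f i) y" "M y (G v i)" using G(1)[OF i] by blast
    then show ?thesis
      by (intro exI[of _ "\<lambda>j. if j = 0 then f i else if j = 1 then y else G v i"]) (auto simp: M_refl)
  qed
  define step where
    "step v i = (SOME w. w 0 = f i \<and> (\<forall>j. M (w j) (w (Suc j))) \<and> w 2 = G v i)" for v i
  have "step v i 0 = f i \<and> (\<forall>j. M (step v i j) (step v i (Suc j))) \<and> step v i 2 = G v i"
    if "i < m" for v i unfolding step_def by (rule someI_ex[OF step_ex[OF that]])
  then have step: "step v i 0 = f i" "M (step v i j) (step v i (Suc j))" "step v i 2 = G v i"
    if "i < m" for v i j using that by simp_all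
  define guard where "guard i = launch 0 (g i) (\<lambda>_ _. g i)" for i
  \<comment> \<open>From time \<open>\<tau>\<close> on, \<open>launch\<close> passes exactly
    \<open>r 0, ..., r \<tau>\<close>, so \<open>last hs\<close> is \<open>r \<tau>\<close>.\<close>
  define match where "match \<tau> i = launch \<tau> (f i) (\<lambda>hs. step (last hs) i)" for \<tau> i
  define block where "block \<tau> i = launch \<tau> v0 (\<lambda>hs. walk (e (last hs) i))" for \<tau> i
  define final where "final i = launch 2 v0 (\<lambda>hs. walk (z (hs ! 0) (hs ! 1) (hs ! 2) i))" for i
  define \<Sigma> where "\<Sigma> = guard ` {..<m} \<union> match 0 ` {..<m} \<union> match 1 ` {..<m} \<union>
    block 0 ` {..<k * t} \<union> block 1 ` {..<k * t} \<union> final ` {..<q}"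
  have img: "card (F ` {..<c}) \<le> c" for F :: "nat \<Rightarrow> 'a list \<Rightarrow> 'a" and c
    using card_image_le[of "{..<c}" F] by simp
  have "card \<Sigma> \<le> m + m + m + k * t + k * t + q"
    unfolding \<Sigma>_def
    by (intro order_trans[OF card_Un_le] add_mono img)
  then have "card \<Sigma> \<le> 3 * m + 2 * (k * t) + nat \<lfloor>d\<^sup>2\<rfloor>" by (simp add: q_def)
  moreover have "finite \<Sigma>" by (simp add: \<Sigma>_def)
  moreover have "\<sigma> [] \<in> V \<and> (\<forall>hs x. M (\<sigma> hs) (\<sigma> (hs @ [x])))" if "\<sigma> \<in> \<Sigma>" for \<sigma>
    using that f(1) g(1) v0
    by (auto simp: \<Sigma>_def guard_def match_def block_def final_def launch_move)
  moreover have "\<exists>t. \<exists>\<sigma>\<in>\<Sigma>. \<sigma> (map r [0..<Suc t]) = r t"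
    if r0: "r 0 \<in> V" and r: "\<And>t. M (r t) (r (Suc t))" for r
  proof (rule ccontr)
    assume "\<not> ?thesis"
    then have evade: "\<sigma> (map r [0..<Suc t]) \<noteq> r t" if "\<sigma> \<in> \<Sigma>" for \<sigma> t using that by blast
    have rV: "r t \<in> V" for t by (induction t) (use r0 r M_closed in auto)
    have last: "last (map r [0..<Suc \<tau>]) = r \<tau>" for \<tau> by simp
    have guarded: "\<not> M (g i) (r t)" if "i < m" for i t
      using launch_evaded[of "\<lambda>_ _. g i" "g i" 0 r t] evade[of "guard i"] that
      by (auto simp: \<Sigma>_def guard_def M_refl simp del: upt_Suc)
    then have rR: "r t \<in> R" for t using rV by (auto simp: R_def)
    have matched: "G (r \<tau>) i \<noteq> r (Suc \<tau>)" if "i < m" "\<tau> = 0 \<or> \<tau> = 1" for i \<tau>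
    proof -
      have "match \<tau> i \<in> \<Sigma>" using that by (auto simp: \<Sigma>_def)
      \<comment> \<open>When \<open>r (Suc \<tau>)\<close> is played the cop has made one step and
        its target is one move away, so the robber cannot be on that target.\<close>
      then have "\<not> M (step (r \<tau>) i (Suc \<tau> - \<tau>)) (r (Suc \<tau>))"
        using launch_evaded[of "\<lambda>hs. step (last hs) i" "f i" \<tau> r "Suc \<tau>"] evade[of "match \<tau> i"] step that(1)
        unfolding match_def last by blast
      then show ?thesis using step(2)[OF that(1), of "r \<tau>" 1] step(3)[OF that(1), of "r \<tau>"]
        by (auto simp: numeral_2_eq_2)
    qed
    have inA: "r (Suc \<tau>) \<in> A (r \<tau>)" if "\<tau> = 0 \<or> \<tau> = 1" for \<tau>
    proof (rule ccontr)
      assume "r (Suc \<tau>) \<notin> A (r \<tau>)"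
      then have "r (Suc \<tau>) \<in> nbhd {r \<tau>} \<inter> R - A (r \<tau>)" using r rR by (auto simp: nbhd_def)
      then show False using G(2) matched that by blast
    qed
    \<comment> \<open>Stated for every possible \<open>y\<close>, not just the vertex played,
      because \<open>Z\<close> ranges over all candidates for \<open>r 3\<close>.\<close>
    have inW: "y \<in> W (r \<tau>)" if "\<tau> = 0 \<or> \<tau> = 1" "M (r (Suc \<tau>)) y" "y \<in> R" for \<tau> y
      using inA[OF that(1)] that(2,3) by (auto simp: W_def nbhd_def)
    have inT: "r (\<tau> + 3) \<in> T (r \<tau>) (r (\<tau> + 2))" if "\<tau> = 0 \<or> \<tau> = 1" for \<tau>
    proof -
      have move: "M (r (\<tau> + 2)) (r (\<tau> + 3))" using r[of "\<tau> + 2"] by (simp add: eval_nat_numeral)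
      have "r (\<tau> + 2) \<in> W (r \<tau>)" using inW[OF that _ rR] r[of "Suc \<tau>"] by simp
      then have "r (\<tau> + 3) \<in> S (r \<tau>)" using move rR by (auto simp: S_def nbhd_def)
      moreover have "r (\<tau> + 3) \<notin> nbhd (P (r \<tau>))"
      proof
        assume "r (\<tau> + 3) \<in> nbhd (P (r \<tau>))"
        then obtain i where i: "i < k * t" "M (e (r \<tau>) i) (r (\<tau> + 3))"
          using e(2)[of "r \<tau>"] by (auto simp: nbhd_def)
        have "block \<tau> i \<in> \<Sigma>" using that i by (auto simp: \<Sigma>_def)
        \<comment> \<open>Three moves after launching, the blocker already stands on its vertex of
          \<open>P (r \<tau>)\<close>, so its neighbours are lethal too.\<close>
        then have "\<not> M (walk (e (r \<tau>) i) (\<tau> + 3 - \<tau>)) (r (\<tau> + 3))"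
          using launch_evaded[of "\<lambda>hs. walk (e (last hs) i)" v0 \<tau> r "\<tau> + 3"] evade[of "block \<tau> i"]
            walk e(1) unfolding block_def last by blast
        then show False using i walk(3)[OF e(1)] by simp
      qed
      ultimately show ?thesis using move by (simp add: T_def)
    qed
    have "r 4 \<in> Z (r 0) (r 1) (r 2)"
      using inT[of 0] inT[of 1] by (auto simp: Z_def numeral_2_eq_2 numeral_3_eq_3 eval_nat_numeral)
    moreover have "card (Z (r 0) (r 1) (r 2)) \<le> q"
    proof -
      have "r 2 \<in> W (r 0)" using inW[of 0, OF _ _ rR] r[of 1] by (simp add: numeral_2_eq_2)
      then have c0: "card (T (r 0) (r 2)) \<le> d" using cardT rR by blast
      have c1: "card (T (r 1) y) \<le> d" if "y \<in> T (r 0) (r 2)" for y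
        using that inW[of 1 y] cardT rR by (auto simp: T_def S_def numeral_2_eq_2)
      have "card (Z (r 0) (r 1) (r 2)) \<le> (\<Sum>y\<in>T (r 0) (r 2). card (T (r 1) y))"
        unfolding Z_def using finite_subset[OF TV finite_V] by (intro card_UN_le)
      also have "real \<dots> \<le> (\<Sum>y\<in>T (r 0) (r 2). d)"
        using c1 by (simp only: of_nat_sum) (rule sum_mono)
      also have "\<dots> = card (T (r 0) (r 2)) * d" by simp
      also have "\<dots> \<le> d * d" using c0 by (intro mult_right_mono) auto
      finally show ?thesis by (simp add: q_def power2_eq_square le_nat_floor)
    qed
    ultimately obtain i where i: "i < q" "r 4 = z (r 0) (r 1) (r 2) i" using z(2) by blast
    have "final i \<in> \<Sigma>" using i by (auto simp: \<Sigma>_def)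
    \<comment> \<open>Launched at time 2, a final cop has made only two moves when
      \<open>r 4\<close> is played; the third lands on its target, so the target must be
      \<open>r 4\<close> itself.\<close>
    then have "\<not> M (walk (z (r 0) (r 1) (r 2) i) (4 - 2)) (r 4)"
      using launch_evaded[of "\<lambda>hs. walk (z (hs ! 0) (hs ! 1) (hs ! 2) i)" v0 2 r 4] evade[of "final i"]
        walk(1,2)[OF z(1)] by (simp add: final_def nth_append flip: numeral_2_eq_2 del: One_nat_def)
    then show False
      using walk(2)[OF z(1), of "r 0" "r 1" "r 2" i 2] walk(3)[OF z(1), of "r 0" "r 1" "r 2" i] i
      by (simp add: numeral_3_eq_3 numeral_2_eq_2)
  qed
  ultimately show ?thesis by blast
qed

end

section \<open>Transfer to the game on digraphs\<close>

lemma pair_graph_reflexive_graph: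
  assumes "pair_graph G"
  shows "reflexive_graph (pverts G) (game_move G)"
proof -
  interpret pair_graph G by fact
  show ?thesis
  proof
    show "game_move G u v \<Longrightarrow> game_move G v u" for u v
      using pair_sym_arcs by (auto simp: game_move_def symmetric_def sym_def)
    show "u \<in> pverts G \<Longrightarrow> game_move G u v \<Longrightarrow> v \<in> pverts G" for u v
      by (auto simp: game_move_def dest: in_arcsD2)
  qed (auto simp: game_move_def pair_finite_verts)
qed

lemma diameter_le_3_moves:
  assumes "pair_graph G" "graph_diameter G \<le> 3" "x \<in> pverts G" "y \<in> pverts G"
  shows "\<exists>a b. game_move G x a \<and> game_move G a b \<and> game_move G b y"
proof -
  interpret pair_graph G by fact
  have "\<mu> (\<lambda>_. 1) x y \<le> graph_diameter G"
    unfolding graph_diameter_def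
    by (rule SUP_upper2[OF assms(3)], rule SUP_upper2[OF assms(4)], rule order_refl)
  \<comment> \<open>Strictness turns the infimum into an actual walk; its length is an integer below
    4, and shorter walks are padded by staying.\<close>
  then have "\<mu> (\<lambda>_. 1) x y < 4" using assms(2) by (rule order.strict_trans1[OF order_trans]) simp
  then obtain p where p: "awalk x p y" "ereal (awalk_cost (\<lambda>_. 1) p) < 4"
    unfolding \<mu>_def by (auto simp: INF_less_iff)
  have "awalk_cost (\<lambda>_. 1) p = length p" by (simp add: awalk_cost_def sum_list_triv)
  then have "real (length p) < 4" using p(2) by simp
  then have "length p < 4" by simp
  then have "length p = 0 \<or> length p = 1 \<or> length p = 2 \<or> length p = 3" by arith
  then show ?thesis using p(1)
    by (auto simp: game_move_def length_Suc_conv numeral_2_eq_2 numeral_3_eq_3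
        awalk_Cons_iff awalk_Nil_iff) blast+
qed

lemma cops_win_card:
  assumes fin: "finite \<Sigma>"
    and legal: "\<And>\<sigma>. \<sigma> \<in> \<Sigma> \<Longrightarrow> \<sigma> [] \<in> pverts G"
      "\<And>\<sigma> hs x. \<sigma> \<in> \<Sigma> \<Longrightarrow> game_move G (\<sigma> hs) (\<sigma> (hs @ [x]))"
    and win: "\<And>r. robber_play G r \<Longrightarrow> \<exists>t. \<exists>\<sigma>\<in>\<Sigma>. \<sigma> (map r [0..<Suc t]) = r t"
  shows "cops_win G (card \<Sigma>)"
proof -
  obtain b where b: "bij_betw b {..<card \<Sigma>} \<Sigma>"
    using ex_bij_betw_nat_finite[OF fin] by (auto simp: atLeast0LessThan)
  have inb: "b i \<in> \<Sigma>" if "i < card \<Sigma>" for i using b that by (auto simp: bij_betw_def)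
  have "cop_strategy G (card \<Sigma>) (\<lambda>hs i. b i hs)"
    using legal inb by (simp add: cop_strategy_def)
  moreover have "\<exists>t. \<exists>i<card \<Sigma>. b i (map r [0..<Suc t]) = r t" if "robber_play G r" for r
  proof -
    obtain t \<sigma> where \<sigma>: "\<sigma> \<in> \<Sigma>" "\<sigma> (map r [0..<Suc t]) = r t" using win[OF \<open>robber_play G r\<close>] by blast
    then obtain i where "i < card \<Sigma>" "b i = \<sigma>"
      using b by (metis bij_betw_imp_surj_on imageE lessThan_iff)
    then show ?thesis using \<sigma> by blast
  qed
  ultimately show ?thesis unfolding cops_win_def by (intro exI[of _ "\<lambda>hs i. b i hs"]) simp
qed

lemma cop_number_diameter_3:
  fixes L d :: real
  assumes G: "pair_graph G" "graph_diameter G \<le> 3" "2 \<le> card (pverts G)"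
    and L: "0 < L" and m: "6 * real (card (pverts G)) * ln (card (pverts G)) \<le> L * real m"
    and k: "0 < k" and t: "card (pverts G) < 2 ^ t"
    and d: "d = 12 * L\<^sup>2 * ln (card (pverts G)) / k"
  shows "cop_number G \<le> 3 * m + 2 * (k * t) + nat \<lfloor>d\<^sup>2\<rfloor>"
proof -
  interpret reflexive_graph "pverts G" "game_move G" using G(1) by (rule pair_graph_reflexive_graph)
  obtain \<Sigma> where \<Sigma>: "finite \<Sigma>" "card \<Sigma> \<le> 3 * m + 2 * (k * t) + nat \<lfloor>d\<^sup>2\<rfloor>"
    and legal: "\<forall>\<sigma>\<in>\<Sigma>. \<sigma> [] \<in> pverts G \<and> (\<forall>hs x. game_move G (\<sigma> hs) (\<sigma> (hs @ [x])))"
    and win: "\<forall>r. r 0 \<in> pverts G \<longrightarrow> (\<forall>t. game_move G (r t) (r (Suc t))) \<longrightarrow>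
      (\<exists>t. \<exists>\<sigma>\<in>\<Sigma>. \<sigma> (map r [0..<Suc t]) = r t)"
    using exists_winning_team[OF G(3) diameter_le_3_moves[OF G(1,2)] L m k t d] by blast
  have "cops_win G (card \<Sigma>)"
    by (rule cops_win_card[OF \<Sigma>(1)]) (use legal win in \<open>auto simp: robber_play_def simp del: upt_Suc\<close>)
  then have "cop_number G \<le> card \<Sigma>" unfolding cop_number_def by (rule Least_le)
  then show ?thesis using \<Sigma>(2) by linarith
qed

section \<open>Choice of parameters and asymptotics\<close>

theorem theorem7:
  shows "\<exists>\<epsilon> :: nat \<Rightarrow> real. \<epsilon> \<longlonglongrightarrow> 0 \<and>
    (\<forall>n\<ge>2. \<forall>G :: 'a pair_pre_digraph.
       pair_graph G \<and> card (pverts G) = n \<and> graph_diameter G \<le> 3 \<longrightarrow>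
       real (cop_number G) < real n powr (4 / 7 + \<epsilon> n))"
proof -
  \<comment> \<open>\<open>\<phi>\<close> collects the logarithmic factors of the summands in units
    of \<open>x\<close>, its final 1 giving strictness; \<open>\<epsilon>\<close> is chosen so that
    \<open>n powr \<epsilon> n = \<phi> n\<close>.\<close>
  define \<phi> :: "nat \<Rightarrow> real" where
    "\<phi> n = 3 * (6 * ln n + 1) + 4 * (log 2 n + 2) + 144 * (ln n)\<^sup>2 + 1" for n
  define \<epsilon> where "\<epsilon> n = ln (\<phi> n) / ln n" for n
  have lim: "\<epsilon> \<longlonglongrightarrow> 0" unfolding \<epsilon>_def \<phi>_def by real_asymp
  have "real (cop_number G) < real n powr (4 / 7 + \<epsilon> n)"
    if n2: "2 \<le> n" and G: "pair_graph G" "card (pverts G) = n" "graph_diameter G \<le> 3"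
    for n and G :: "'a pair_pre_digraph"
  proof -
    define x where "x = real n powr (4 / 7)"
    \<comment> \<open>The exponent balances the team sizes: with \<open>L = n powr a\<close> and
      \<open>k\<close> about \<open>n / L\<close>, \<open>L ^ 4 / k\<^sup>2\<close> is about
      \<open>n / L\<close> when \<open>6 * a - 2 = 1 - a\<close>.\<close>
    define L where "L = real n powr (3 / 7)"
    define m where "m = nat \<lceil>6 * ln n * x\<rceil>"
    define k where "k = nat \<lceil>x\<rceil>"
    define t where "t = nat \<lceil>log 2 n\<rceil> + 1"
    define d where "d = 12 * L\<^sup>2 * ln n / k"
    have n: "1 < real n" using n2 by simp
    have ln: "0 < ln (real n)" and lg: "0 < log 2 n" using n by auto
    have x: "1 \<le> x" unfolding x_def using n by (intro ge_one_powr_ge_zero) auto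
    have L: "0 < L" using n by (simp add: L_def)
    have Lx: "L * x = n" using n by (simp add: L_def x_def powr_add[symmetric])
    have L4: "L ^ 4 = x ^ 3" using n by (simp add: L_def x_def powr_power)
    have m1: "6 * ln n * x \<le> m" unfolding m_def by linarith
    have m2: "m \<le> 6 * ln n * x + 1" unfolding m_def using ln x by (simp add: of_nat_nat)
    have k1: "x \<le> k" unfolding k_def by linarith
    have k2: "k \<le> x + 1" unfolding k_def using x by linarith
    have t1: "t \<le> log 2 n + 2" unfolding t_def using lg by linarith
    have t2: "n < 2 ^ t"
    proof -
      have "log 2 n < t" unfolding t_def by linarith
      then have "real n < 2 powr t" using n by (simp add: log_less_iff)
      then show ?thesis by (simp add: powr_realpow)
    qed
    have "6 * real n * ln n = L * (6 * ln n * x)" using Lx by (simp add: mult_ac)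
    also have "\<dots> \<le> L * m" using m1 L by (intro mult_left_mono) auto
    finally have m3: "6 * real n * ln n \<le> L * m" .
    have k0: "0 < k" using k1 x by linarith
    have "d\<^sup>2 = 144 * (ln n)\<^sup>2 * (L ^ 4 / k\<^sup>2)"
      by (simp add: d_def power_divide power_mult_distrib power_mult[symmetric])
    also have "\<dots> \<le> 144 * (ln n)\<^sup>2 * (x ^ 3 / x\<^sup>2)"
      unfolding L4 using k1 x by (intro mult_left_mono divide_left_mono power_mono) auto
    also have "x ^ 3 / x\<^sup>2 = x" using x by (simp add: power2_eq_square power3_eq_cube)
    finally have d2: "d\<^sup>2 \<le> 144 * (ln n)\<^sup>2 * x" .
    have "cop_number G \<le> 3 * m + 2 * (k * t) + nat \<lfloor>d\<^sup>2\<rfloor>"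
      using cop_number_diameter_3[OF G(1,3), of L m k t d] n2 G(2) L m3 k0 t2
      by (simp add: d_def)
    then have "real (cop_number G) \<le> real (3 * m + 2 * (k * t) + nat \<lfloor>d\<^sup>2\<rfloor>)"
      by (rule of_nat_mono)
    also have "\<dots> = 3 * real m + 2 * (real k * real t) + real (nat \<lfloor>d\<^sup>2\<rfloor>)" by simp
    also have "\<dots> \<le> 3 * (6 * ln n * x + 1) + 2 * ((2 * x) * (log 2 n + 2)) + 144 * (ln n)\<^sup>2 * x"
    proof (intro add_mono mult_left_mono mult_mono)
      show "real k \<le> 2 * x" using k2 x by linarith
      show "real (nat \<lfloor>d\<^sup>2\<rfloor>) \<le> 144 * (ln n)\<^sup>2 * x" using d2 by (simp add: of_nat_nat) linarith
    qed (use m2 t1 x in auto)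
    also have "\<dots> \<le> (\<phi> n - 1) * x" using x by (simp add: \<phi>_def algebra_simps)
    also have "\<dots> < \<phi> n * x" using x by (simp add: algebra_simps)
    also have "\<dots> = x * \<phi> n" by simp
    also have "\<phi> n = real n powr \<epsilon> n"
    proof -
      have "0 < \<phi> n" unfolding \<phi>_def using ln lg by (intro add_nonneg_pos add_nonneg_nonneg) auto
      then show ?thesis using ln n by (simp add: powr_def \<epsilon>_def)
    qed
    finally show ?thesis by (simp add: x_def powr_add)
  qed
  then show ?thesis using lim by (intro exI[of _ \<epsilon>]) blast
qed

end
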